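(* Let $\kappa$ be a regular (infinite) cardinal and let $(X,\leq)$ be a $\kappa$-saturated model of the theory of dense linear orderings without endpoints with $|X|=\kappa$. Then $(X,\leq)$ is sunflowerable.
   Context: A set $Y$ of finite sets is a sunflower if there is a set $r$ such that $p\cap q=r$ for all distinct $p,q\in Y$. For $n\in\omega$, an infinite structure $\mathcal{M}$ is $n$-sunflowerable if for every structure $\mathcal{Y}\cong\mathcal{M}$ all of whose elements are sets of size $n$, there is a substructure $\mathcal{Z}\subseteq\mathcal{Y}$ with $\mathcal{Z}\cong\mathcal{Y}$ whose underlying set $Z$ is a sunflower. $\mathcal{M}$ is sunflowerable if it is $n$-sunflowerable for every $n\in\omega$. *)

theory Defs
  imports Main
begin

unbundle cardinal_syntax

text \<open>
  A structure in the language of one binary relation symbol is given by a universe \<open>X\<close> and a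
  relation \<open>R \<subseteq> X \<times> X\<close>. The symbol is read as \<open>\<le>\<close>.
\<close>

definition dlo_without_endpoints :: "'a set \<Rightarrow> 'a rel \<Rightarrow> bool" where
  "dlo_without_endpoints X R \<longleftrightarrow>
     X \<noteq> {} \<and> linear_order_on X R \<and>
     (\<forall>x\<in>X. \<forall>y\<in>X. (x, y) \<in> R \<and> x \<noteq> y \<longrightarrow>
        (\<exists>z\<in>X. (x, z) \<in> R \<and> x \<noteq> z \<and> (z, y) \<in> R \<and> z \<noteq> y)) \<and>
     (\<forall>x\<in>X. \<exists>y\<in>X. (y, x) \<in> R \<and> y \<noteq> x) \<and>
     (\<forall>x\<in>X. \<exists>y\<in>X. (x, y) \<in> R \<and> x \<noteq> y)"

datatype (trm_params: 'a) trm = Var nat | Par 'a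

datatype (params: 'a) fm =
    Eq "'a trm" "'a trm"
  | Le "'a trm" "'a trm"
  | Neg "'a fm"
  | And "'a fm" "'a fm"
  | Ex nat "'a fm"

fun trm_vars :: "'a trm \<Rightarrow> nat set" where
  "trm_vars (Var i) = {i}"
| "trm_vars (Par a) = {}"

fun free_vars :: "'a fm \<Rightarrow> nat set" where
  "free_vars (Eq s t) = trm_vars s \<union> trm_vars t"
| "free_vars (Le s t) = trm_vars s \<union> trm_vars t"
| "free_vars (Neg \<phi>) = free_vars \<phi>"
| "free_vars (And \<phi> \<psi>) = free_vars \<phi> \<union> free_vars \<psi>"
| "free_vars (Ex i \<phi>) = free_vars \<phi> - {i}"

fun trm_val :: "(nat \<Rightarrow> 'a) \<Rightarrow> 'a trm \<Rightarrow> 'a" where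
  "trm_val v (Var i) = v i"
| "trm_val v (Par a) = a"

fun sat :: "'a set \<Rightarrow> 'a rel \<Rightarrow> (nat \<Rightarrow> 'a) \<Rightarrow> 'a fm \<Rightarrow> bool" where
  "sat X R v (Eq s t) \<longleftrightarrow> trm_val v s = trm_val v t"
| "sat X R v (Le s t) \<longleftrightarrow> (trm_val v s, trm_val v t) \<in> R"
| "sat X R v (Neg \<phi>) \<longleftrightarrow> \<not> sat X R v \<phi>"
| "sat X R v (And \<phi> \<psi>) \<longleftrightarrow> sat X R v \<phi> \<and> sat X R v \<psi>"
| "sat X R v (Ex i \<phi>) \<longleftrightarrow> (\<exists>x\<in>X. sat X R (v(i := x)) \<phi>)"

definition fms_over :: "'a set \<Rightarrow> 'a fm set" where
  "fms_over A = {\<phi>. params \<phi> \<subseteq> A \<and> free_vars \<phi> \<subseteq> {0}}"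

text \<open>
  Used only for \<open>\<Gamma> \<subseteq> fms_over A\<close>: no variable other than \<open>0\<close> is free in \<open>\<Gamma>\<close>, so the values of
  the constant valuation at the other variables are irrelevant.
\<close>

definition realizes :: "'a set \<Rightarrow> 'a rel \<Rightarrow> 'a \<Rightarrow> 'a fm set \<Rightarrow> bool" where
  "realizes X R x \<Gamma> \<longleftrightarrow> (\<forall>\<phi>\<in>\<Gamma>. sat X R (\<lambda>_. x) \<phi>)"

text \<open>
  A (partial) \<open>1\<close>-type over \<open>A\<close>. Since the elementary diagram of \<open>(X, R)\<close> is complete,
  consistency with it amounts to every finite part being realized in \<open>(X, R)\<close>.
\<close>

definition type_over :: "'a set \<Rightarrow> 'a rel \<Rightarrow> 'a set \<Rightarrow> 'a fm set \<Rightarrow> bool" where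
  "type_over X R A \<Gamma> \<longleftrightarrow>
     \<Gamma> \<subseteq> fms_over A \<and> (\<forall>\<Delta>\<subseteq>\<Gamma>. finite \<Delta> \<longrightarrow> (\<exists>x\<in>X. realizes X R x \<Delta>))"

definition saturated :: "'k rel \<Rightarrow> 'a set \<Rightarrow> 'a rel \<Rightarrow> bool" where
  "saturated \<kappa> X R \<longleftrightarrow>
     (\<forall>A\<subseteq>X. |A| <o \<kappa> \<longrightarrow>
        (\<forall>\<Gamma>. type_over X R A \<Gamma> \<longrightarrow> (\<exists>x\<in>X. realizes X R x \<Gamma>)))"

definition sunflower :: "'b set set \<Rightarrow> bool" where
  "sunflower Y \<longleftrightarrow> (\<exists>r. \<forall>p\<in>Y. \<forall>q\<in>Y. p \<noteq> q \<longrightarrow> p \<inter> q = r)"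

definition isomorphic :: "'a set \<Rightarrow> 'a rel \<Rightarrow> 'b set \<Rightarrow> 'b rel \<Rightarrow> bool" where
  "isomorphic X R Y S \<longleftrightarrow>
     (\<exists>f. bij_betw f X Y \<and> (\<forall>x\<in>X. \<forall>y\<in>X. (x, y) \<in> R \<longleftrightarrow> (f x, f y) \<in> S))"

text \<open>
  The type argument \<open>'b\<close> provides the members of the \<open>n\<close>-element sets that form the
  structures \<open>(Y, S)\<close>. Definitions cannot quantify over types, so sunflowerability in the sense of
  set theory is the statement for all \<open>'b\<close>, that is, with \<open>'b\<close> a free type variable in a theorem.
\<close>

definition n_sunflowerable :: "'b itself \<Rightarrow> nat \<Rightarrow> 'a set \<Rightarrow> 'a rel \<Rightarrow> bool" where
  "n_sunflowerable (_ :: 'b itself) n X R \<longleftrightarrow>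
     infinite X \<and>
     (\<forall>(Y :: 'b set set) S.
        S \<subseteq> Y \<times> Y \<and> isomorphic Y S X R \<and> (\<forall>p\<in>Y. finite p \<and> card p = n) \<longrightarrow>
        (\<exists>Z\<subseteq>Y. isomorphic Z (Restr S Z) Y S \<and> sunflower Z))"

definition sunflowerable :: "'b itself \<Rightarrow> 'a set \<Rightarrow> 'a rel \<Rightarrow> bool" where
  "sunflowerable TB X R \<longleftrightarrow> (\<forall>n. n_sunflowerable TB n X R)"

end

theory Submission
  imports Defs
begin

text \<open>
  Saturation makes \<open>X\<close> an \<open>\<eta>\<close>-ordering: any two subsets \<open>A < B\<close> of size less than \<open>\<kappa>\<close> have a
  point between them. Hence every linear ordering of size \<open>\<kappa>\<close> embeds into each subset meeting all
  such gaps. Now let the points of \<open>X\<close> be labelled by \<open>n\<close>-element sets. If every gap contains a point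
  whose label avoids any prescribed set of fewer than \<open>\<kappa>\<close> elements, the recursion that embeds \<open>X\<close>
  into itself can keep all labels disjoint. Otherwise some gap is covered by fewer than \<open>\<kappa>\<close> classes
  of the form ``the label contains \<open>a\<close>''. By regularity of \<open>\<kappa>\<close>, one of these classes is dense in a
  smaller gap, so it contains a copy of \<open>X\<close>, and one removes \<open>a\<close> from the labels and inducts on \<open>n\<close>.
\<close>

section \<open>Recursion with choices along a well-order\<close>

lemma well_order_dependent_choice:
  fixes W :: "'a rel" and \<Phi> :: "('a \<Rightarrow> 'b) \<Rightarrow> 'a \<Rightarrow> 'b \<Rightarrow> bool"
  assumes W: "Well_order W"
    and cong: "\<And>f g x y. (\<And>z. z \<in> underS W x \<Longrightarrow> f z = g z) \<Longrightarrow> \<Phi> f x y \<Longrightarrow> \<Phi> g x y"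
    and step: "\<And>f x. x \<in> Field W \<Longrightarrow> (\<And>z. z \<in> underS W x \<Longrightarrow> \<Phi> f z (f z)) \<Longrightarrow> \<exists>y. \<Phi> f x y"
  shows "\<exists>f. \<forall>x\<in>Field W. \<Phi> f x (f x)"
proof -
  interpret wo_rel W using W by (simp add: wo_rel_def)
  \<comment> \<open>One witness is chosen per stage from the values found so far. By
    \<open>cong\<close> the choice at \<open>x\<close> depends only on values strictly below
    \<open>x\<close>, which is the admissibility that \<open>worec\<close> asks for.\<close>
  define H where "H = (\<lambda>f x. SOME y. \<Phi> f x y)"
  have "adm_wo H"
    unfolding adm_wo_def
  proof (intro allI impI)
    fix f g :: "'a \<Rightarrow> 'b" and x assume "\<forall>y\<in>underS x. f y = g y"
    then have "\<Phi> f x = \<Phi> g x"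
      by (intro ext iffI) (auto intro: cong[of x f g] cong[of x g f])
    then show "H f x = H g x" by (simp add: H_def)
  qed
  then have fixpoint: "worec H = H (worec H)" by (rule worec_fixpoint)
  have "x \<in> Field W \<longrightarrow> \<Phi> (worec H) x (worec H x)" for x
  proof (induction x rule: well_order_induct)
    case (1 x)
    show ?case
    proof
      assume "x \<in> Field W"
      have "\<exists>y. \<Phi> (worec H) x y"
        using 1 by (intro step[OF \<open>x \<in> Field W\<close>]) (auto simp: underS_def Field_def)
      then have "\<Phi> (worec H) x (H (worec H) x)"
        unfolding H_def by (rule someI_ex)
      then show "\<Phi> (worec H) x (worec H x)" using fixpoint by simp
    qed
  qed
  then show ?thesis by blast
qed

section \<open>Eta-orderings of regular size: the combinatorial core, free of formulas and
  types\<close>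

locale eta_order =
  fixes \<kappa> :: "'k rel" and X :: "'a set" and less :: "'a \<Rightarrow> 'a \<Rightarrow> bool" (infix "\<prec>" 50)
  assumes Card: "Card_order \<kappa>" and inf: "infinite (Field \<kappa>)" and regular: "regularCard \<kappa>"
    and card_X: "|X| =o \<kappa>"
    and irrefl: "\<not> x \<prec> x"
    and trans: "x \<in> X \<Longrightarrow> y \<in> X \<Longrightarrow> z \<in> X \<Longrightarrow> x \<prec> y \<Longrightarrow> y \<prec> z \<Longrightarrow> x \<prec> z"
    and total: "x \<in> X \<Longrightarrow> y \<in> X \<Longrightarrow> x \<noteq> y \<Longrightarrow> x \<prec> y \<or> y \<prec> x"
    and eta: "A \<subseteq> X \<Longrightarrow> B \<subseteq> X \<Longrightarrow> |A| <o \<kappa> \<Longrightarrow> |B| <o \<kappa> \<Longrightarrow> (\<And>a b. a \<in> A \<Longrightarrow> b \<in> B \<Longrightarrow> a \<prec> b)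
      \<Longrightarrow> \<exists>x\<in>X. (\<forall>a\<in>A. a \<prec> x) \<and> (\<forall>b\<in>B. x \<prec> b)"
begin

definition between :: "'a set \<Rightarrow> 'a set \<Rightarrow> 'a set" where
  "between A B = {x\<in>X. (\<forall>a\<in>A. a \<prec> x) \<and> (\<forall>b\<in>B. x \<prec> b)}"

text \<open>Either side may be empty, so the two ends of the order, and even all of
  \<open>X\<close>, count as gaps.\<close>

definition gap :: "'a set \<Rightarrow> 'a set \<Rightarrow> bool" where
  "gap A B \<longleftrightarrow> A \<subseteq> X \<and> B \<subseteq> X \<and> |A| <o \<kappa> \<and> |B| <o \<kappa> \<and> (\<forall>a\<in>A. \<forall>b\<in>B. a \<prec> b)"

lemma between_nonempty: "gap A B \<Longrightarrow> between A B \<noteq> {}"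
  using eta[of A B] unfolding gap_def between_def by blast

lemma between_anti_mono: "A \<subseteq> A' \<Longrightarrow> B \<subseteq> B' \<Longrightarrow> between A' B' \<subseteq> between A B"
  unfolding between_def by blast

lemma small_Un: "|A| <o \<kappa> \<Longrightarrow> |B| <o \<kappa> \<Longrightarrow> |A \<union> B| <o \<kappa>"
  by (rule card_of_Un_ordLess_infinite_Field[OF inf Card])

lemma small_finite: "finite A \<Longrightarrow> |A| <o \<kappa>"
  using finite_ordLess_infinite[OF card_of_Well_order, of \<kappa> A] Card inf
  by (simp add: Field_card_of card_order_on_well_order_on)

lemma small_image: "|A| <o \<kappa> \<Longrightarrow> |f ` A| <o \<kappa>"
  using card_of_image ordLeq_ordLess_trans by blast

lemma small_subset: "|A| <o \<kappa> \<Longrightarrow> B \<subseteq> A \<Longrightarrow> |B| <o \<kappa>"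
  using card_of_mono1 ordLeq_ordLess_trans by blast

text \<open>The place where regularity of \<open>\<kappa>\<close> enters.\<close>

lemma small_UN: "|A| <o \<kappa> \<Longrightarrow> (\<And>a. a \<in> A \<Longrightarrow> |F a| <o \<kappa>) \<Longrightarrow> |\<Union>a\<in>A. F a| <o \<kappa>"
  by (rule stable_UNION[OF regularCard_stable[OF Card inf regular]])

text \<open>Given a point on the left of one gap and a point on the right of another, the larger of
  the two gaps contains both, hence they are in order. Regularity keeps the unions small.\<close>

lemma gap_Union_chain:
  assumes small: "|\<G>| <o \<kappa>" and gaps: "\<And>A B. (A, B) \<in> \<G> \<Longrightarrow> gap A B"
    and chain: "\<And>p q. p \<in> \<G> \<Longrightarrow> q \<in> \<G> \<Longrightarrow>
      fst p \<subseteq> fst q \<and> snd p \<subseteq> snd q \<or> fst q \<subseteq> fst p \<and> snd q \<subseteq> snd p"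
  shows "gap (\<Union>(fst ` \<G>)) (\<Union>(snd ` \<G>))"
proof -
  have gaps': "gap (fst p) (snd p)" if "p \<in> \<G>" for p
    using gaps that by (cases p) auto
  have "a \<prec> b" if "p \<in> \<G>" "q \<in> \<G>" "a \<in> fst p" "b \<in> snd q" for a b p q
    using chain[OF that(1,2)] gaps'[OF that(1)] gaps'[OF that(2)] that(3,4)
    unfolding gap_def by blast
  moreover have "|\<Union>(fst ` \<G>)| <o \<kappa>" "|\<Union>(snd ` \<G>)| <o \<kappa>"
    using gaps' by (auto intro!: small_UN small simp: gap_def)
  ultimately show ?thesis
    using gaps' unfolding gap_def by blast
qed

text \<open>The forth half of back-and-forth: points of \<open>X\<close> are placed in
  \<open>P\<close> one after another. The relation \<open>q\<close> is a side condition that each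
  new image must satisfy towards all earlier ones, hence the disjunction in the conclusion.\<close>

lemma embedding_exists:
  assumes P: "P \<subseteq> X"
    and dense: "\<And>A B. gap A B \<Longrightarrow> A \<union> B \<subseteq> P \<Longrightarrow> \<exists>y \<in> P \<inter> between A B. \<forall>e \<in> A \<union> B. q e y"
  shows "\<exists>h. h ` X \<subseteq> P \<and> (\<forall>x\<in>X. \<forall>y\<in>X. x \<prec> y \<longrightarrow> h x \<prec> h y) \<and>
    (\<forall>x\<in>X. \<forall>y\<in>X. x \<noteq> y \<longrightarrow> q (h x) (h y) \<or> q (h y) (h x))"
proof -
  have WX: "Well_order |X|" by (rule card_of_Well_order)
  interpret W: wo_rel "|X|" using WX by (simp add: wo_rel_def)
  define \<Phi> where "\<Phi> f x y \<longleftrightarrow> y \<in> P \<and>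
    (\<forall>z\<in>W.underS x. (z \<prec> x \<longrightarrow> f z \<prec> y) \<and> (x \<prec> z \<longrightarrow> y \<prec> f z) \<and> q (f z) y)" for f x y
  have under: "x \<in> W.underS y \<or> y \<in> W.underS x" if "x \<in> X" "y \<in> X" "x \<noteq> y" for x y
    using that W.TOTALS by (auto simp: underS_def Field_card_of)
  have sub: "W.underS x \<subseteq> X" for x
    using underS_Field[of _ "|X|" x] by (auto simp: Field_card_of)
  have step: "\<exists>y. \<Phi> f x y"
    if x: "x \<in> Field |X|" and IH: "\<And>z. z \<in> W.underS x \<Longrightarrow> \<Phi> f z (f z)" for f x
  proof -
    define L where "L = {z \<in> W.underS x. z \<prec> x}"
    define U where "U = {z \<in> W.underS x. x \<prec> z}"
    have xX: "x \<in> X" using x by (simp add: Field_card_of)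
    \<comment> \<open>The cardinal \<open>|X|\<close> is an initial well-order, so fewer than
      \<open>\<kappa>\<close> points precede \<open>x\<close>.\<close>
    have small: "|W.underS x| <o \<kappa>"
      using card_of_underS[OF card_of_Card_order x] card_X ordLess_ordIso_trans by blast
    have fP: "f z \<in> P" if "z \<in> W.underS x" for z
      using IH[OF that] by (simp add: \<Phi>_def)
    \<comment> \<open>Of \<open>z\<close> and \<open>z'\<close>, the one that comes later in the
      well-order was placed correctly with respect to the other.\<close>
    have mono: "f z \<prec> f z'" if z: "z \<in> L" and z': "z' \<in> U" for z z'
    proof -
      have "z \<prec> z'"
        using z z' sub[of x] xX trans[of z x z'] by (auto simp: L_def U_def)
      moreover from this have "z \<in> W.underS z' \<or> z' \<in> W.underS z"
        using z z' sub[of x] irrefl by (intro under) (auto simp: L_def U_def)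
      ultimately show ?thesis
        using IH[of z] IH[of z'] z z' unfolding \<Phi>_def L_def U_def by blast
    qed
    have "gap (f ` L) (f ` U)"
      unfolding gap_def
    proof (intro conjI ballI)
      show "f ` L \<subseteq> X" "f ` U \<subseteq> X" using fP P by (auto simp: L_def U_def)
      show "|f ` L| <o \<kappa>" "|f ` U| <o \<kappa>"
        by (auto simp: L_def U_def intro!: small_image intro: small_subset[OF small])
    qed (use mono in auto)
    moreover have "f ` L \<union> f ` U \<subseteq> P" using fP by (auto simp: L_def U_def)
    ultimately obtain y where y: "y \<in> P \<inter> between (f ` L) (f ` U)" "\<forall>e \<in> f ` L \<union> f ` U. q e y"
      using dense[of "f ` L" "f ` U"] by auto
    have LU: "z \<in> L \<union> U" if "z \<in> W.underS x" for z
      using that total[of z x] sub[of x] xX by (auto simp: L_def U_def underS_def)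
    have "(z \<prec> x \<longrightarrow> f z \<prec> y) \<and> (x \<prec> z \<longrightarrow> y \<prec> f z) \<and> q (f z) y" if "z \<in> W.underS x" for z
      using y LU[OF that] that by (auto simp: between_def L_def U_def)
    then have "\<Phi> f x y" using y(1) by (simp add: \<Phi>_def)
    then show ?thesis ..
  qed
  have cong: "\<Phi> g x y" if "\<And>z. z \<in> W.underS x \<Longrightarrow> f z = g z" "\<Phi> f x y" for f g x y
    using that by (simp add: \<Phi>_def)
  have "\<exists>h. \<forall>x\<in>Field |X|. \<Phi> h x (h x)"
    by (rule well_order_dependent_choice[OF WX]) (fact cong, fact step)
  then obtain h where h: "\<And>x. x \<in> X \<Longrightarrow> \<Phi> h x (h x)"
    by (auto simp: Field_card_of)
  show ?thesis
  proof (intro exI[of _ h] conjI ballI impI)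
    show "h ` X \<subseteq> P" using h by (auto simp: \<Phi>_def)
    show "h x \<prec> h y" if "x \<in> X" "y \<in> X" "x \<prec> y" for x y
      using under[of x y] h[of x] h[of y] that irrefl unfolding \<Phi>_def by blast
    show "q (h x) (h y) \<or> q (h y) (h x)" if "x \<in> X" "y \<in> X" "x \<noteq> y" for x y
      using under[of x y] h[of x] h[of y] that unfolding \<Phi>_def by blast
  qed
qed

text \<open>A Baire category argument: if no class is dense in any gap, the gap
  \<open>(A, B)\<close> can be narrowed successively so as to lose the classes \<open>C a\<close>
  one by one. The union of all stages is still a gap, and a point filling it lies in no
  class.\<close>

lemma covered_gap_has_dense_class:
  assumes U: "|U| <o \<kappa>" and AB: "gap A B" and cover: "between A B \<subseteq> (\<Union>a\<in>U. C a)"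
  shows "\<exists>a\<in>U. \<exists>A' B'. gap A' B' \<and>
    (\<forall>A'' B''. gap A'' B'' \<and> A' \<subseteq> A'' \<and> B' \<subseteq> B'' \<longrightarrow> C a \<inter> between A'' B'' \<noteq> {})"
proof (rule ccontr)
  assume "\<not> ?thesis"
  then have shrink: "\<exists>A'' B''. gap A'' B'' \<and> A' \<subseteq> A'' \<and> B' \<subseteq> B'' \<and> C a \<inter> between A'' B'' = {}"
    if "a \<in> U" "gap A' B'" for a A' B'
    using that by blast
  have WU: "Well_order |U|" by (rule card_of_Well_order)
  interpret W: wo_rel "|U|" using WU by (simp add: wo_rel_def)
  \<comment> \<open>The stage \<open>a\<close> yields a pair \<open>y\<close> that extends
    \<open>(A, B)\<close> and all earlier pairs and whose gap misses \<open>C a\<close>.\<close>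
  define \<Phi> where "\<Phi> f a y \<longleftrightarrow> gap (fst y) (snd y) \<and> A \<subseteq> fst y \<and> B \<subseteq> snd y \<and>
    (\<forall>j\<in>W.underS a. fst (f j) \<subseteq> fst y \<and> snd (f j) \<subseteq> snd y) \<and>
    C a \<inter> between (fst y) (snd y) = {}" for f a and y :: "'a set \<times> 'a set"
  have under: "x \<in> W.underS y \<or> y \<in> W.underS x" if "x \<in> U" "y \<in> U" "x \<noteq> y" for x y
    using that W.TOTALS by (auto simp: underS_def Field_card_of)
  have sub: "W.underS x \<subseteq> U" for x
    using underS_Field[of _ "|U|" x] by (auto simp: Field_card_of)
  \<comment> \<open>Needed for initial segments \<open>J\<close> in the recursion step and for
    \<open>J = U\<close> at the end. The inserted pair \<open>(A, B)\<close> covers the case of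
    empty \<open>J\<close>.\<close>
  have gap_Un: "gap (\<Union>(fst ` insert (A, B) (f ` J))) (\<Union>(snd ` insert (A, B) (f ` J)))"
    if J: "J \<subseteq> U" and \<Phi>: "\<And>j. j \<in> J \<Longrightarrow> \<Phi> f j (f j)" for f J
  proof (rule gap_Union_chain)
    have "|{(A, B)} \<union> f ` J| <o \<kappa>"
      by (intro small_Un small_finite small_image small_subset[OF U J]) simp
    then show "|insert (A, B) (f ` J)| <o \<kappa>" by simp
    show "gap A' B'" if "(A', B') \<in> insert (A, B) (f ` J)" for A' B'
      using that
    proof
      assume "(A', B') = (A, B)"
      then show ?thesis using AB by simp
    next
      assume "(A', B') \<in> f ` J"
      then obtain j where "j \<in> J" "f j = (A', B')" by force
      then show ?thesis using \<Phi>[of j] by (simp add: \<Phi>_def)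
    qed
    have above: "A \<subseteq> fst (f j)" "B \<subseteq> snd (f j)" if "j \<in> J" for j
      using \<Phi>[OF that] by (auto simp: \<Phi>_def)
    have "fst (f i) \<subseteq> fst (f j) \<and> snd (f i) \<subseteq> snd (f j) \<or>
        fst (f j) \<subseteq> fst (f i) \<and> snd (f j) \<subseteq> snd (f i)" if "i \<in> J" "j \<in> J" for i j
      using under[of i j] \<Phi>[OF that(1)] \<Phi>[OF that(2)] that J unfolding \<Phi>_def by blast
    then show "fst p \<subseteq> fst q \<and> snd p \<subseteq> snd q \<or> fst q \<subseteq> fst p \<and> snd q \<subseteq> snd p"
      if "p \<in> insert (A, B) (f ` J)" "q \<in> insert (A, B) (f ` J)" for p q
      using that above by (elim insertE imageE) simp_all
  qed
  have step: "\<exists>y. \<Phi> f a y"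
    if a: "a \<in> Field |U|" and IH: "\<And>j. j \<in> W.underS a \<Longrightarrow> \<Phi> f j (f j)" for f a
  proof -
    have "a \<in> U" using a by (simp add: Field_card_of)
    from shrink[OF this gap_Un[of "W.underS a" f, OF sub IH]]
    obtain A' B' where "gap A' B'" "C a \<inter> between A' B' = {}"
      "\<Union>(fst ` insert (A, B) (f ` W.underS a)) \<subseteq> A'"
      "\<Union>(snd ` insert (A, B) (f ` W.underS a)) \<subseteq> B'"
      by auto
    then have "\<Phi> f a (A', B')" by (auto simp: \<Phi>_def)
    then show ?thesis ..
  qed
  have cong: "\<Phi> g x y" if "\<And>z. z \<in> W.underS x \<Longrightarrow> f z = g z" "\<Phi> f x y" for f g x y
    using that by (simp add: \<Phi>_def)
  have "\<exists>f. \<forall>a\<in>Field |U|. \<Phi> f a (f a)"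
    by (rule well_order_dependent_choice[OF WU]) (fact cong, fact step)
  then obtain f where f: "\<And>a. a \<in> U \<Longrightarrow> \<Phi> f a (f a)"
    by (auto simp: Field_card_of)
  obtain x where x: "x \<in> between (\<Union>(fst ` insert (A, B) (f ` U))) (\<Union>(snd ` insert (A, B) (f ` U)))"
    using between_nonempty[OF gap_Un[OF subset_refl f]] by blast
  have "x \<in> between A B" using x unfolding between_def by simp
  then obtain a where a: "a \<in> U" "x \<in> C a" using cover by blast
  \<comment> \<open>A point filling the union of all stages fills each single stage, so it avoids
    every \<open>C a\<close>, contrary to the cover.\<close>
  have "x \<in> between (fst (f a)) (snd (f a))"
    using x a(1) by (elim rev_subsetD[OF _ between_anti_mono]) auto
  then show False using f[OF a(1)] a(2) by (auto simp: \<Phi>_def)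
qed

text \<open>The labelling \<open>g\<close> is arbitrary in the induction because the hypothesis is
  applied to the labels pulled back along an embedding and with a common element removed.\<close>

lemma sunflower_embedding:
  fixes g :: "'a \<Rightarrow> 'b set"
  assumes "\<And>x. x \<in> X \<Longrightarrow> finite (g x) \<and> card (g x) = n"
  shows "\<exists>h r. h ` X \<subseteq> X \<and> (\<forall>x\<in>X. \<forall>y\<in>X. x \<prec> y \<longrightarrow> h x \<prec> h y) \<and>
    (\<forall>x\<in>X. \<forall>y\<in>X. x \<noteq> y \<longrightarrow> g (h x) \<inter> g (h y) = r)"
  using assms
proof (induction n arbitrary: g)
  case 0
  then have "\<forall>x\<in>X. g x = {}" using card_0_eq by blast
  then show ?case by (intro exI[of _ id] exI[of _ "{}"]) auto
next
  case (Suc n)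
  show ?case
  proof (cases "\<forall>A B (U :: 'b set). gap A B \<and> |U| <o \<kappa> \<longrightarrow> (\<exists>x\<in>between A B. g x \<inter> U = {})")
    case True
    \<comment> \<open>The set to avoid consists of all elements of labels on
      \<open>A \<union> B\<close>. It is small because the labels are finite.\<close>
    have "\<exists>y \<in> X \<inter> between A B. \<forall>e \<in> A \<union> B. g e \<inter> g y = {}" if AB: "gap A B" for A B
    proof -
      have "|A \<union> B| <o \<kappa>" using AB by (intro small_Un) (auto simp: gap_def)
      then have "|\<Union>e\<in>A \<union> B. g e| <o \<kappa>"
        by (rule small_UN) (use AB Suc.prems in \<open>auto simp: gap_def intro: small_finite\<close>)
      then obtain y where "y \<in> between A B" "g y \<inter> (\<Union>e\<in>A \<union> B. g e) = {}"
        using True AB by blast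
      then show ?thesis unfolding between_def by blast
    qed
    then have "\<exists>h. h ` X \<subseteq> X \<and> (\<forall>x\<in>X. \<forall>y\<in>X. x \<prec> y \<longrightarrow> h x \<prec> h y) \<and>
        (\<forall>x\<in>X. \<forall>y\<in>X. x \<noteq> y \<longrightarrow> g (h x) \<inter> g (h y) = {} \<or> g (h y) \<inter> g (h x) = {})"
      by (intro embedding_exists) simp_all
    then obtain h where "h ` X \<subseteq> X" "\<forall>x\<in>X. \<forall>y\<in>X. x \<prec> y \<longrightarrow> h x \<prec> h y"
      "\<forall>x\<in>X. \<forall>y\<in>X. x \<noteq> y \<longrightarrow> g (h x) \<inter> g (h y) = {}"
      by (auto simp: Int_commute)
    then show ?thesis by (intro exI[of _ h] exI[of _ "{}"] conjI)
  next
    case False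
    then obtain A B and U :: "'b set" where AB: "gap A B" "|U| <o \<kappa>"
      and "\<not> (\<exists>x\<in>between A B. g x \<inter> U = {})"
      unfolding not_all not_imp by (elim exE conjE)
    then have "between A B \<subseteq> (\<Union>a\<in>U. {x. a \<in> g x})" by auto
    then obtain a A' B' where AB': "gap A' B'" and dense:
      "\<forall>A'' B''. gap A'' B'' \<and> A' \<subseteq> A'' \<and> B' \<subseteq> B'' \<longrightarrow> {x. a \<in> g x} \<inter> between A'' B'' \<noteq> {}"
      using covered_gap_has_dense_class[OF AB(2,1), of "\<lambda>a. {x. a \<in> g x}"] by auto
    \<comment> \<open>The dense class inside its gap. Any gap with sides \<open>C\<close> and
      \<open>D\<close> in \<open>P\<close> can be narrowed by adding \<open>A'\<close> and
      \<open>B'\<close>, and density then provides a point of \<open>P\<close>. No side condition is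
      wanted here, so \<open>q\<close> is constantly true.\<close>
    define P where "P = {x. a \<in> g x} \<inter> between A' B'"
    have "P \<subseteq> X" by (auto simp: P_def between_def)
    moreover have "\<exists>y \<in> P \<inter> between C D. \<forall>e \<in> C \<union> D. True"
      if CD: "gap C D" "C \<union> D \<subseteq> P" for C D
    proof -
      have "gap (A' \<union> C) (B' \<union> D)"
        using AB' CD by (auto simp: gap_def P_def between_def intro!: small_Un)
      then have "{x. a \<in> g x} \<inter> between (A' \<union> C) (B' \<union> D) \<noteq> {}"
        using dense by auto
      then show ?thesis unfolding P_def between_def by blast
    qed
    ultimately have "\<exists>h. h ` X \<subseteq> P \<and> (\<forall>x\<in>X. \<forall>y\<in>X. x \<prec> y \<longrightarrow> h x \<prec> h y) \<and>
        (\<forall>x\<in>X. \<forall>y\<in>X. x \<noteq> y \<longrightarrow> True \<or> True)"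
      by (rule embedding_exists)
    then obtain h where h: "h ` X \<subseteq> P" "\<forall>x\<in>X. \<forall>y\<in>X. x \<prec> y \<longrightarrow> h x \<prec> h y"
      by (elim exE conjE)
    have hX: "h x \<in> X" "a \<in> g (h x)" if "x \<in> X" for x
      using h(1) that by (auto simp: P_def between_def)
    have "finite (g (h x) - {a}) \<and> card (g (h x) - {a}) = n" if "x \<in> X" for x
      using Suc.prems[OF hX(1)[OF that]] hX(2)[OF that] by simp
    then have "\<exists>k r. k ` X \<subseteq> X \<and> (\<forall>x\<in>X. \<forall>y\<in>X. x \<prec> y \<longrightarrow> k x \<prec> k y) \<and>
        (\<forall>x\<in>X. \<forall>y\<in>X. x \<noteq> y \<longrightarrow> (g (h (k x)) - {a}) \<inter> (g (h (k y)) - {a}) = r)"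
      by (rule Suc.IH)
    then obtain k r where
      k: "k ` X \<subseteq> X" "\<forall>x\<in>X. \<forall>y\<in>X. x \<prec> y \<longrightarrow> k x \<prec> k y"
        "\<forall>x\<in>X. \<forall>y\<in>X. x \<noteq> y \<longrightarrow> (g (h (k x)) - {a}) \<inter> (g (h (k y)) - {a}) = r"
      by (elim exE conjE)
    have kX: "k x \<in> X" if "x \<in> X" for x using k(1) that by blast
    \<comment> \<open>All labels on \<open>P\<close> contain \<open>a\<close>, so restoring it adds
      \<open>a\<close> to the kernel.\<close>
    have "g (h (k x)) \<inter> g (h (k y)) = insert a r" if "x \<in> X" "y \<in> X" "x \<noteq> y" for x y
      using k(3)[rule_format, OF that] hX(2)[OF kX[OF that(1)]] hX(2)[OF kX[OF that(2)]] by blast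
    then show ?thesis
      using h(2) k(2) kX hX(1) by (intro exI[of _ "h \<circ> k"] exI[of _ "insert a r"]) auto
  qed
qed

end

section \<open>From saturation to the filling of gaps\<close>

lemma linear_order_finite_max:
  assumes lin: "linear_order_on X R" and "finite A" "A \<noteq> {}" "A \<subseteq> X"
  shows "\<exists>m\<in>A. \<forall>a\<in>A. (a, m) \<in> R"
  using assms(2-)
proof (induction A rule: finite_ne_induct)
  case (singleton x)
  then show ?case using lin by (auto simp: order_on_defs refl_on_def)
next
  case (insert x F)
  then obtain m where m: "m \<in> F" "\<forall>a\<in>F. (a, m) \<in> R" by auto
  have "x \<in> X" "m \<in> X" "x \<noteq> m" using m insert by auto
  then consider "(x, m) \<in> R" | "(m, x) \<in> R" "(x, x) \<in> R"
    using lin by (auto simp: order_on_defs total_on_def refl_on_def)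
  then show ?case
  proof cases
    case 1
    then show ?thesis using m by blast
  next
    case 2
    have "(a, x) \<in> R" if "a \<in> F" for a
      using lin m(2) 2(1) that by (auto simp: order_on_defs dest: transD)
    then show ?thesis using 2(2) by blast
  qed
qed

text \<open>Only the maximum of \<open>A\<close> and the minimum of \<open>B\<close> matter: density
  applies if both exist, the absence of endpoints if just one does.\<close>

lemma dlo_finite_between:
  assumes dlo: "dlo_without_endpoints X R" and A: "finite A" "A \<subseteq> X" and B: "finite B" "B \<subseteq> X"
    and AB: "\<And>a b. a \<in> A \<Longrightarrow> b \<in> B \<Longrightarrow> (a, b) \<in> R \<and> a \<noteq> b"
  shows "\<exists>x\<in>X. (\<forall>a\<in>A. (a, x) \<in> R \<and> a \<noteq> x) \<and> (\<forall>b\<in>B. (x, b) \<in> R \<and> x \<noteq> b)"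
proof -
  have lin: "linear_order_on X R" using dlo by (simp add: dlo_without_endpoints_def)
  have tr: "(x, z) \<in> R \<and> x \<noteq> z"
    if "(x, y) \<in> R" "(y, z) \<in> R" "x \<noteq> y \<or> y \<noteq> z" for x y z
  proof -
    have "(x, z) \<in> R" using lin that(1,2) by (auto simp: order_on_defs dest: transD)
    then show ?thesis using lin that by (auto simp: order_on_defs dest: antisymD)
  qed
  have max: "\<exists>m\<in>A. \<forall>a\<in>A. (a, m) \<in> R" if "A \<noteq> {}"
    using linear_order_finite_max[OF lin A(1) that A(2)] .
  \<comment> \<open>The minimum is the maximum in the converse order.\<close>
  have min: "\<exists>m\<in>B. \<forall>b\<in>B. (m, b) \<in> R" if "B \<noteq> {}"
    using linear_order_finite_max[of X "R\<inverse>", OF _ B(1) that B(2)] lin by simp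
  obtain c where c: "c \<in> X" using dlo by (auto simp: dlo_without_endpoints_def)
  have dense: "\<exists>z\<in>X. (x, z) \<in> R \<and> x \<noteq> z \<and> (z, y) \<in> R \<and> z \<noteq> y"
    if "x \<in> X" "y \<in> X" "(x, y) \<in> R" "x \<noteq> y" for x y
    using dlo that unfolding dlo_without_endpoints_def by blast
  have lower: "\<exists>y\<in>X. (y, x) \<in> R \<and> y \<noteq> x" and upper: "\<exists>y\<in>X. (x, y) \<in> R \<and> x \<noteq> y"
    if "x \<in> X" for x
    using dlo that unfolding dlo_without_endpoints_def by blast+
  consider "A = {}" "B = {}" | m where "A = {}" "m \<in> B" "\<forall>b\<in>B. (m, b) \<in> R"
    | m where "B = {}" "m \<in> A" "\<forall>a\<in>A. (a, m) \<in> R"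
    | m m' where "m \<in> A" "\<forall>a\<in>A. (a, m) \<in> R" "m' \<in> B" "\<forall>b\<in>B. (m', b) \<in> R"
    using max min by blast
  then show ?thesis
  proof cases
    case 1
    then show ?thesis using c by blast
  next
    case (2 m)
    then obtain x where "x \<in> X" "(x, m) \<in> R" "x \<noteq> m" using lower B(2) by blast
    then show ?thesis using 2 tr by blast
  next
    case (3 m)
    then obtain x where "x \<in> X" "(m, x) \<in> R" "m \<noteq> x" using upper A(2) by blast
    then show ?thesis using 3 tr by blast
  next
    case (4 m m')
    then obtain x where "x \<in> X" "(m, x) \<in> R" "m \<noteq> x" "(x, m') \<in> R" "x \<noteq> m'"
      using dense[of m m'] AB[of m m'] A(2) B(2) by blast
    then show ?thesis using 4 tr by blast
  qed
qed

text \<open>The inequalities asking for a point of the gap form a type over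
  \<open>A \<union> B\<close>: a finite part mentions finitely many parameters and is realized by
  \<open>dlo_finite_between\<close>.\<close>

lemma saturated_between:
  fixes \<kappa> :: "'k rel" and X :: "'a set"
  assumes Card: "Card_order \<kappa>" and inf: "infinite (Field \<kappa>)"
    and dlo: "dlo_without_endpoints X R" and sat: "saturated \<kappa> X R"
    and A: "A \<subseteq> X" "|A| <o \<kappa>" and B: "B \<subseteq> X" "|B| <o \<kappa>"
    and AB: "\<And>a b. a \<in> A \<Longrightarrow> b \<in> B \<Longrightarrow> (a, b) \<in> R \<and> a \<noteq> b"
  shows "\<exists>x\<in>X. (\<forall>a\<in>A. (a, x) \<in> R \<and> a \<noteq> x) \<and> (\<forall>b\<in>B. (x, b) \<in> R \<and> x \<noteq> b)"
proof -
  \<comment> \<open>Strict inequalities with the type variable \<open>Var 0\<close>, built from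
    \<open>Le\<close> and \<open>Eq\<close>.\<close>
  define F where "F a = And (Le (Par a) (Var 0)) (Neg (Eq (Par a) (Var 0)))" for a :: 'a
  define G where "G b = And (Le (Var 0) (Par b)) (Neg (Eq (Var 0) (Par b)))" for b :: 'a
  have realizes_iff: "realizes X R x (F ` A' \<union> G ` B') \<longleftrightarrow>
      (\<forall>a\<in>A'. (a, x) \<in> R \<and> a \<noteq> x) \<and> (\<forall>b\<in>B'. (x, b) \<in> R \<and> x \<noteq> b)" for x A' B'
    by (auto simp: realizes_def F_def G_def ball_Un)
  have "type_over X R (A \<union> B) (F ` A \<union> G ` B)"
    unfolding type_over_def
  proof (intro conjI allI impI)
    show "F ` A \<union> G ` B \<subseteq> fms_over (A \<union> B)"
      by (auto simp: fms_over_def F_def G_def)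
    fix \<Delta> assume "\<Delta> \<subseteq> F ` A \<union> G ` B" "finite \<Delta>"
    then obtain A' B' where "A' \<subseteq> A" "finite A'" "B' \<subseteq> B" "finite B'" "\<Delta> = F ` A' \<union> G ` B'"
      by (metis finite_Un finite_subset_image subset_UnE)
    then show "\<exists>x\<in>X. realizes X R x \<Delta>"
      using dlo_finite_between[OF dlo, of A' B'] A(1) B(1) AB
      by (simp add: realizes_iff subset_iff)
  qed
  moreover have "|A \<union> B| <o \<kappa>"
    by (rule card_of_Un_ordLess_infinite_Field[OF inf Card A(2) B(2)])
  ultimately have "\<exists>x\<in>X. realizes X R x (F ` A \<union> G ` B)"
    using sat[unfolded saturated_def, rule_format, of "A \<union> B"] A(1) B(1) by simp
  then show ?thesis unfolding realizes_iff .
qed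

section \<open>Transfer to structures of finite sets\<close>

theorem lemma2p18:
  fixes \<kappa> :: "'k rel" and X :: "'a set" and R :: "'a rel"
  assumes "Card_order \<kappa>" and "infinite (Field \<kappa>)" and "regularCard \<kappa>"
    and "dlo_without_endpoints X R" and "saturated \<kappa> X R" and "|X| =o \<kappa>"
  shows "sunflowerable TYPE('b) X R"
proof -
  have lin: "linear_order_on X R" using assms(4) by (simp add: dlo_without_endpoints_def)
  have refl: "(x, x) \<in> R" if "x \<in> X" for x
    using lin that by (auto simp: order_on_defs refl_on_def)
  interpret eta_order \<kappa> X "\<lambda>x y. (x, y) \<in> R \<and> x \<noteq> y"
  proof
    show "(x, z) \<in> R \<and> x \<noteq> z" if "(x, y) \<in> R \<and> x \<noteq> y" "(y, z) \<in> R \<and> y \<noteq> z" for x y z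
      using lin that by (auto simp: order_on_defs dest: transD antisymD)
    show "((x, y) \<in> R \<and> x \<noteq> y) \<or> ((y, x) \<in> R \<and> y \<noteq> x)" if "x \<in> X" "y \<in> X" "x \<noteq> y" for x y
      using lin that by (auto simp: order_on_defs total_on_def)
  qed (use assms saturated_between[OF assms(1,2,4,5)] in auto)
  have inf_X: "infinite X"
    using assms(2,6) card_of_ordIso_finite_Field[OF assms(1)] ordIso_symmetric by blast
  have copy: "\<exists>Z\<subseteq>Y. isomorphic Z (Restr S Z) Y S \<and> sunflower Z"
    if S: "S \<subseteq> Y \<times> Y" and iso: "isomorphic Y S X R" and Y: "\<forall>p\<in>Y. finite p \<and> card p = n"
    for n and Y :: "'b set set" and S
  proof -
    obtain f where f: "bij_betw f Y X" "\<And>p q. p \<in> Y \<Longrightarrow> q \<in> Y \<Longrightarrow> (p, q) \<in> S \<longleftrightarrow> (f p, f q) \<in> R"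
      using iso unfolding isomorphic_def by blast
    \<comment> \<open>The inverse isomorphism labels each point of \<open>X\<close> with a set of
      size \<open>n\<close>.\<close>
    define g where "g = inv_into Y f"
    have g: "g x \<in> Y" "f (g x) = x" if "x \<in> X" for x
      using f(1) that unfolding g_def by (auto simp: bij_betw_def inv_into_into f_inv_into_f)
    have "finite (g x) \<and> card (g x) = n" if "x \<in> X" for x
      using Y g(1)[OF that] by blast
    from sunflower_embedding[of g, OF this] obtain h r where h: "h ` X \<subseteq> X"
      "\<forall>x\<in>X. \<forall>y\<in>X. (x, y) \<in> R \<and> x \<noteq> y \<longrightarrow> (h x, h y) \<in> R \<and> h x \<noteq> h y"
      "\<forall>x\<in>X. \<forall>y\<in>X. x \<noteq> y \<longrightarrow> g (h x) \<inter> g (h y) = r"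
      by auto
    have hX: "h x \<in> X" if "x \<in> X" for x using h(1) that by blast
    have fX: "f p \<in> X" if "p \<in> Y" for p using f(1) that by (auto simp: bij_betw_def)
    \<comment> \<open>In a linear order, a strictly increasing map is injective and also reflects
      the order.\<close>
    have h_inj: "h x \<noteq> h y" if "x \<in> X" "y \<in> X" "x \<noteq> y" for x y
      using total[OF that] h(2)[rule_format, of x y] h(2)[rule_format, of y x] that by auto
    have h_iff: "(h x, h y) \<in> R \<longleftrightarrow> (x, y) \<in> R" if "x \<in> X" "y \<in> X" for x y
    proof (cases "x = y")
      case True
      then show ?thesis using refl that hX by simp
    next
      case False
      then show ?thesis
        using total[OF that False] trans[OF hX hX hX, of x y x] h(2)[rule_format, of x y]
          h(2)[rule_format, of y x] lin that by (auto simp: order_on_defs dest: antisymD)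
    qed
    \<comment> \<open>The self-embedding \<open>h\<close> of \<open>X\<close>, conjugated to a
      self-embedding of \<open>Y\<close>. Its image is the required substructure, and
      \<open>inv_into Y e\<close> the isomorphism back onto \<open>Y\<close>.\<close>
    define e where "e p = g (h (f p))" for p
    have e_inj: "inj_on e Y"
    proof (rule inj_onI)
      fix p q assume pq: "p \<in> Y" "q \<in> Y" "e p = e q"
      then have "h (f p) = h (f q)" unfolding e_def using g(2) hX fX by metis
      then have "f p = f q" using h_inj fX pq by blast
      then show "p = q" using f(1) pq by (auto simp: bij_betw_def dest: inj_onD)
    qed
    have eY: "e ` Y \<subseteq> Y" using g(1) hX fX by (auto simp: e_def)
    have e_iff: "(e p, e q) \<in> S \<longleftrightarrow> (p, q) \<in> S" if "p \<in> Y" "q \<in> Y" for p q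
      using that f(2) g hX fX h_iff by (simp add: e_def)
    have "bij_betw (inv_into Y e) (e ` Y) Y"
      by (rule bij_betw_inv_into[OF inj_on_imp_bij_betw[OF e_inj]])
    moreover have "(p, q) \<in> Restr S (e ` Y) \<longleftrightarrow> (inv_into Y e p, inv_into Y e q) \<in> S"
      if "p \<in> e ` Y" "q \<in> e ` Y" for p q
      using that e_inj e_iff by auto
    ultimately have "isomorphic (e ` Y) (Restr S (e ` Y)) Y S"
      unfolding isomorphic_def by blast
    moreover have "sunflower (e ` Y)"
      unfolding sunflower_def
    proof (intro exI[of _ r] ballI impI)
      fix s t assume "s \<in> e ` Y" "t \<in> e ` Y" and "s \<noteq> t"
      then obtain p q where pq: "p \<in> Y" "q \<in> Y" "s = e p" "t = e q" by blast
      then have "f p \<noteq> f q" using \<open>s \<noteq> t\<close> by (auto simp: e_def)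
      then show "s \<inter> t = r" using h(3) fX pq by (simp add: e_def)
    qed
    ultimately show ?thesis using eY by blast
  qed
  show ?thesis
    unfolding sunflowerable_def n_sunflowerable_def
    by (intro allI conjI impI inf_X, elim conjE, rule copy)
qed

end
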